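(* The property of $M(X)$ being weakly finite is not a coarse invariant of metric spaces: there exist coarsely equivalent metric spaces $X$ and $Y$ such that $M(X)$ is weakly finite and $M(Y)$ is not weakly finite.
   Context: The inverse semigroup $M(X)$ of a metric space $(X,d_X)$: the double of $X$ is $X\sqcup X'$, where $X=X\times\{0\}$ and $X'=X\times\{1\}$ are two copies of $X$; write $x=(x,0)$ and $x'=(x,1)$. Let $\mathcal M(X)$ be the set of all metrics $d$ on $X\sqcup X'$ whose restriction to each of the two copies of $X$ is $d_X$ and which satisfy $\inf_{x,y\in X}d(x,y')>0$. Two metrics $b,d$ on a set $Z$ are coarsely equivalent if there are monotone functions $\varphi,\psi:[0,\infty)\to[0,\infty)$ with $\lim_{t\to\infty}\varphi(t)=\lim_{t\to\infty}\psi(t)=\infty$ such that $\varphi(d(z_1,z_2))\le b(z_1,z_2)\le\psi(d(z_1,z_2))$ for all $z_1,z_2\in Z$; $[d]$ denotes the coarse equivalence class of $d$. $M(X)$ is the set of coarse equivalence classes of metrics in $\mathcal M(X)$, with multiplication $[\rho][d]=[\rho\circ d]$, where $\rho\circ d\in\mathcal M(X)$ is determined by $(\rho\circ d)(x,z')=\inf_{y\in X}[d(x,y')+\rho(y,z')]$ for $x,z\in X$. It is known that this is well defined and that $M(X)$ is an inverse semigroup; the pseudo-inverse of $s=[d]$ is $s^*=[d^*]$ with $d^*(x,y')=d(x',y)$, and the unit $\mathbf 1$ is the class of the metric $d(x,y')=d_X(x,y)+1$. Finiteness: let $S$ be an inverse semigroup with set of idempotents $E(S)$, partially ordered by $f\le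 e$ iff $f=fe$. Idempotents $e,f$ are equivalent, $e\sim f$, if there is $s\in S$ with $s^*s=e$ and $ss^*=f$. An idempotent $e$ is infinite if there is $f\in E(S)$ with $f\le e$, $f\ne e$ and $f\sim e$; otherwise $e$ is finite. $S$ is weakly finite if it is unital and its unit is a finite idempotent. Coarse equivalence of metric spaces is understood in the usual sense; in particular, $(X,d)$ and $(X,b)$ are coarsely equivalent if the metrics $d$ and $b$ on the same set $X$ are coarsely equivalent in the sense above. *)

theory Defs
  imports "HOL-Analysis.Abstract_Metric_Spaces" "HOL-Algebra.Group"
begin

section \<open>Coarse equivalence\<close>

definition coarse_control :: "(real \<Rightarrow> real) \<Rightarrow> bool" where
  "coarse_control \<phi> \<longleftrightarrow>
     \<phi> \<in> {0..} \<rightarrow> {0..} \<and> mono_on {0..} \<phi> \<and> filterlim \<phi> at_top at_top"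

definition coarsely_equivalent_metrics ::
  "'a set \<Rightarrow> ('a \<Rightarrow> 'a \<Rightarrow> real) \<Rightarrow> ('a \<Rightarrow> 'a \<Rightarrow> real) \<Rightarrow> bool" where
  "coarsely_equivalent_metrics Z b d \<longleftrightarrow>
     (\<exists>\<phi> \<psi>. coarse_control \<phi> \<and> coarse_control \<psi> \<and>
        (\<forall>z\<^sub>1\<in>Z. \<forall>z\<^sub>2\<in>Z. \<phi> (d z\<^sub>1 z\<^sub>2) \<le> b z\<^sub>1 z\<^sub>2 \<and> b z\<^sub>1 z\<^sub>2 \<le> \<psi> (d z\<^sub>1 z\<^sub>2)))"

text \<open>A coarse equivalence of spaces is a coarse embedding whose image is a net.\<close>

definition coarsely_equivalent_spaces ::
  "'a set \<Rightarrow> ('a \<Rightarrow> 'a \<Rightarrow> real) \<Rightarrow> 'b set \<Rightarrow> ('b \<Rightarrow> 'b \<Rightarrow> real) \<Rightarrow> bool" where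
  "coarsely_equivalent_spaces X dX Y dY \<longleftrightarrow>
     (\<exists>f \<in> X \<rightarrow> Y.
        (\<exists>\<phi> \<psi>. coarse_control \<phi> \<and> coarse_control \<psi> \<and>
           (\<forall>x\<in>X. \<forall>x'\<in>X. \<phi> (dX x x') \<le> dY (f x) (f x') \<and> dY (f x) (f x') \<le> \<psi> (dX x x'))) \<and>
        (\<exists>C. \<forall>y\<in>Y. \<exists>x\<in>X. dY (f x) y \<le> C))"

section \<open>The inverse semigroup of a metric space\<close>

text \<open>The double of \<open>X\<close> is \<open>X <+> X\<close>, with \<open>x = Inl x\<close> and \<open>x' = Inr x\<close>.
  Metrics are total functions whose values outside the carrier are irrelevant: functions agreeing
  on the double are coarsely equivalent and hence have the same class.
  The space \<open>X\<close> is meant to be nonempty (infima over the empty set are unspecified).\<close>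

definition double_metrics ::
  "'a set \<Rightarrow> ('a \<Rightarrow> 'a \<Rightarrow> real) \<Rightarrow> ('a + 'a \<Rightarrow> 'a + 'a \<Rightarrow> real) set" where
  "double_metrics X dX = {d. Metric_space (X <+> X) d \<and>
     (\<forall>x\<in>X. \<forall>y\<in>X. d (Inl x) (Inl y) = dX x y \<and> d (Inr x) (Inr y) = dX x y) \<and>
     (INF (x, y)\<in>X \<times> X. d (Inl x) (Inr y)) > 0}"

definition double_coarse_rel ::
  "'a set \<Rightarrow> ('a \<Rightarrow> 'a \<Rightarrow> real) \<Rightarrow> ('a + 'a \<Rightarrow> 'a + 'a \<Rightarrow> real) rel" where
  "double_coarse_rel X dX = {(b, d). b \<in> double_metrics X dX \<and> d \<in> double_metrics X dX \<and>
     coarsely_equivalent_metrics (X <+> X) b d}"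

fun double_comp ::
  "'a set \<Rightarrow> ('a \<Rightarrow> 'a \<Rightarrow> real) \<Rightarrow> ('a + 'a \<Rightarrow> 'a + 'a \<Rightarrow> real) \<Rightarrow> ('a + 'a \<Rightarrow> 'a + 'a \<Rightarrow> real)
     \<Rightarrow> 'a + 'a \<Rightarrow> 'a + 'a \<Rightarrow> real" where
  "double_comp X dX \<rho> d (Inl x) (Inl z) = dX x z"
| "double_comp X dX \<rho> d (Inr x) (Inr z) = dX x z"
| "double_comp X dX \<rho> d (Inl x) (Inr z) = (INF y\<in>X. d (Inl x) (Inr y) + \<rho> (Inl y) (Inr z))"
| "double_comp X dX \<rho> d (Inr z) (Inl x) = (INF y\<in>X. d (Inl x) (Inr y) + \<rho> (Inl y) (Inr z))"

fun double_unit :: "('a \<Rightarrow> 'a \<Rightarrow> real) \<Rightarrow> 'a + 'a \<Rightarrow> 'a + 'a \<Rightarrow> real" where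
  "double_unit dX (Inl x) (Inl y) = dX x y"
| "double_unit dX (Inr x) (Inr y) = dX x y"
| "double_unit dX (Inl x) (Inr y) = dX x y + 1"
| "double_unit dX (Inr y) (Inl x) = dX x y + 1"

text \<open>The product is the descent of \<^const>\<open>double_comp\<close> to classes; since it respects
  coarse equivalence, the union below is the single class \<open>[\<rho> \<circ> d]\<close>.\<close>

definition double_semigroup ::
  "'a set \<Rightarrow> ('a \<Rightarrow> 'a \<Rightarrow> real) \<Rightarrow> ('a + 'a \<Rightarrow> 'a + 'a \<Rightarrow> real) set monoid" where
  "double_semigroup X dX =
     \<lparr>carrier = double_metrics X dX // double_coarse_rel X dX,
      mult = (\<lambda>A B. \<Union>\<rho>\<in>A. \<Union>d\<in>B. double_coarse_rel X dX `` {double_comp X dX \<rho> d}),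
      one = double_coarse_rel X dX `` {double_unit dX}\<rparr>"

section \<open>Finite idempotents in inverse semigroups\<close>

text \<open>The following notions are meant for an inverse semigroup \<open>S\<close>, where every \<open>s\<close> has exactly
  one pseudo-inverse \<open>s\<^sup>*\<close>; it is referred to through its defining property.\<close>

definition pseudo_inverse :: "('a, 'b) monoid_scheme \<Rightarrow> 'a \<Rightarrow> 'a \<Rightarrow> bool" where
  "pseudo_inverse S s t \<longleftrightarrow> s \<in> carrier S \<and> t \<in> carrier S \<and>
     s \<otimes>\<^bsub>S\<^esub> t \<otimes>\<^bsub>S\<^esub> s = s \<and> t \<otimes>\<^bsub>S\<^esub> s \<otimes>\<^bsub>S\<^esub> t = t"

definition idempotents :: "('a, 'b) monoid_scheme \<Rightarrow> 'a set" where
  "idempotents S = {e \<in> carrier S. e \<otimes>\<^bsub>S\<^esub> e = e}"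

definition idempotent_le :: "('a, 'b) monoid_scheme \<Rightarrow> 'a \<Rightarrow> 'a \<Rightarrow> bool" where
  "idempotent_le S f e \<longleftrightarrow> f = f \<otimes>\<^bsub>S\<^esub> e"

definition idempotent_equiv :: "('a, 'b) monoid_scheme \<Rightarrow> 'a \<Rightarrow> 'a \<Rightarrow> bool" where
  "idempotent_equiv S e f \<longleftrightarrow>
     (\<exists>s t. pseudo_inverse S s t \<and> t \<otimes>\<^bsub>S\<^esub> s = e \<and> s \<otimes>\<^bsub>S\<^esub> t = f)"

definition infinite_idempotent :: "('a, 'b) monoid_scheme \<Rightarrow> 'a \<Rightarrow> bool" where
  "infinite_idempotent S e \<longleftrightarrow> e \<in> idempotents S \<and>
     (\<exists>f\<in>idempotents S. idempotent_le S f e \<and> f \<noteq> e \<and> idempotent_equiv S f e)"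

definition finite_idempotent :: "('a, 'b) monoid_scheme \<Rightarrow> 'a \<Rightarrow> bool" where
  "finite_idempotent S e \<longleftrightarrow> e \<in> idempotents S \<and> \<not> infinite_idempotent S e"

text \<open>Unitality of the semigroup \<open>S\<close> is expressed by \<^const>\<open>monoid\<close>.\<close>

definition weakly_finite :: "('a, 'b) monoid_scheme \<Rightarrow> bool" where
  "weakly_finite S \<longleftrightarrow> monoid S \<and> finite_idempotent S \<one>\<^bsub>S\<^esub>"

end

theory Submission
  imports Defs
begin

text \<open>In \<open>M(X)\<close> a product \<open>[a][b]\<close> is the unit iff every \<open>x\<close> has some \<open>f x\<close> with \<open>b(x, (f x)')\<close> and
  \<open>a(f x, x')\<close> bounded uniformly; the triangle inequality makes \<open>f\<close> distort distances by a bounded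
  amount, and \<open>[b][a]\<close> is the unit too if the image of \<open>f\<close> is coarsely dense. Hence \<open>M(X)\<close> is weakly
  finite iff every self-map of \<open>X\<close> of bounded additive distortion has coarsely dense image.
  On the natural numbers take the metric \<open>(max x y)\<^sup>2\<close> for \<open>x \<noteq> y\<close>: its gaps grow, so such a map fixes
  all large numbers. The coarsely equivalent metric \<open>ln (1 + (max x y)\<^sup>2)\<close> admits \<open>x \<mapsto> 2x\<close>, which misses
  the odd numbers, and these are far away from everything else.\<close>

section \<open>Coarse equivalence of metrics\<close>

text \<open>One half of coarse equivalence without control functions: in this form metrics are
  compared by chaining bounds, and no monotone functions have to be constructed.\<close>

definition bounded_control :: "'a set \<Rightarrow> ('a \<Rightarrow> 'a \<Rightarrow> real) \<Rightarrow> ('a \<Rightarrow> 'a \<Rightarrow> real) \<Rightarrow> bool" where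
  "bounded_control Z b d \<longleftrightarrow> (\<forall>R. \<exists>S. \<forall>x\<in>Z. \<forall>y\<in>Z. d x y \<le> R \<longrightarrow> b x y \<le> S)"

text \<open>The supremum of \<open>b\<close> over the pairs with \<open>d x y \<le> t\<close> is
  finite by assumption and nondecreasing in \<open>t\<close>. It may stay bounded, so
  \<open>t\<close> is added to force divergence.\<close>

lemma coarse_control_upper:
  assumes "bounded_control Z b d"
  shows "\<exists>\<psi>. coarse_control \<psi> \<and> (\<forall>x\<in>Z. \<forall>y\<in>Z. 0 \<le> d x y \<longrightarrow> b x y \<le> \<psi> (d x y))"
proof -
  \<comment> \<open>The element 0 keeps the set nonempty when no pair qualifies and makes the
    supremum nonnegative.\<close>
  define A where "A t = insert 0 {b x y |x y. x \<in> Z \<and> y \<in> Z \<and> d x y \<le> t}" for t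
  define \<psi> where "\<psi> t = t + Sup (A t)" for t
  have bdd: "bdd_above (A t)" for t
  proof -
    obtain S where "\<And>x y. x \<in> Z \<Longrightarrow> y \<in> Z \<Longrightarrow> d x y \<le> t \<Longrightarrow> b x y \<le> S"
      using assms unfolding bounded_control_def by blast
    then show ?thesis
      unfolding A_def bdd_above_insert by (intro bdd_aboveI[of _ S]) auto
  qed
  have Sup_nonneg: "0 \<le> Sup (A t)" for t
    by (rule cSup_upper[OF _ bdd]) (simp add: A_def)
  have "mono_on {0..} \<psi>"
  proof (rule mono_onI)
    fix s t :: real assume "s \<le> t"
    then have "Sup (A s) \<le> Sup (A t)"
      by (intro cSup_subset_mono bdd) (auto simp: A_def intro: order_trans)
    with \<open>s \<le> t\<close> show "\<psi> s \<le> \<psi> t" by (simp add: \<psi>_def)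
  qed
  moreover have "filterlim \<psi> at_top at_top"
    by (rule filterlim_at_top_mono[OF filterlim_ident]) (simp add: \<psi>_def Sup_nonneg)
  moreover have "b x y \<le> \<psi> (d x y)" if "x \<in> Z" "y \<in> Z" "0 \<le> d x y" for x y
  proof -
    have "b x y \<le> Sup (A (d x y))"
      by (rule cSup_upper[OF _ bdd]) (use that in \<open>auto simp: A_def\<close>)
    with that show ?thesis by (simp add: \<psi>_def)
  qed
  ultimately show ?thesis
    using Sup_nonneg unfolding coarse_control_def
    by (intro exI[of _ \<psi>]) (auto simp: \<psi>_def intro: add_nonneg_nonneg)
qed

text \<open>Dual construction: the infimum of \<open>b\<close> over the pairs with
  \<open>t \<le> d x y\<close>. It diverges because a bound on \<open>b\<close> bounds
  \<open>d\<close>, so pairs at large \<open>d\<close>-distance have large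
  \<open>b\<close>-distance.\<close>

lemma coarse_control_lower:
  assumes "bounded_control Z d b" and nonneg: "\<And>x y. x \<in> Z \<Longrightarrow> y \<in> Z \<Longrightarrow> 0 \<le> b x y"
  shows "\<exists>\<phi>. coarse_control \<phi> \<and> (\<forall>x\<in>Z. \<forall>y\<in>Z. 0 \<le> d x y \<longrightarrow> \<phi> (d x y) \<le> b x y)"
proof -
  \<comment> \<open>On a bounded space no pair is left for large \<open>t\<close>; the element
    \<open>t\<close> keeps the set nonempty and itself tends to infinity.\<close>
  define A where "A t = insert t {b x y |x y. x \<in> Z \<and> y \<in> Z \<and> t \<le> d x y}" for t
  define \<phi> where "\<phi> t = Inf (A t)" for t
  have bdd: "bdd_below (A t)" for t
    using nonneg unfolding A_def bdd_below_insert by (intro bdd_belowI[of _ 0]) auto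
  have "0 \<le> \<phi> t" if "0 \<le> t" for t
    unfolding \<phi>_def by (rule cInf_greatest) (use that nonneg in \<open>auto simp: A_def\<close>)
  moreover have "mono_on {0..} \<phi>"
  proof (rule mono_onI)
    fix s t :: real assume "s \<le> t"
    show "\<phi> s \<le> \<phi> t"
      unfolding \<phi>_def
    proof (rule cInf_mono)
      fix c assume "c \<in> A t"
      then consider "c = t" | x y where "c = b x y" "x \<in> Z" "y \<in> Z" "t \<le> d x y"
        by (auto simp: A_def)
      then show "\<exists>a\<in>A s. a \<le> c"
        using \<open>s \<le> t\<close> by cases (force simp: A_def)+
    qed (use bdd in \<open>auto simp: A_def\<close>)
  qed
  moreover have "filterlim \<phi> at_top at_top"
    unfolding filterlim_at_top
  proof
    fix M
    obtain S where S: "\<And>x y. x \<in> Z \<Longrightarrow> y \<in> Z \<Longrightarrow> b x y \<le> M \<Longrightarrow> d x y \<le> S"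
      using assms(1) unfolding bounded_control_def by blast
    show "\<forall>\<^sub>F t in at_top. M \<le> \<phi> t"
      using eventually_gt_at_top[of "max M S"]
    proof eventually_elim
      case (elim t)
      show ?case
        unfolding \<phi>_def
      proof (rule cInf_greatest)
        fix c assume "c \<in> A t"
        then show "M \<le> c" using elim S by (fastforce simp: A_def)
      qed (simp add: A_def)
    qed
  qed
  moreover have "\<phi> (d x y) \<le> b x y" if "x \<in> Z" "y \<in> Z" for x y
    unfolding \<phi>_def by (rule cInf_lower[OF _ bdd]) (use that in \<open>auto simp: A_def\<close>)
  ultimately show ?thesis
    unfolding coarse_control_def by blast
qed

lemma coarse_control_bounded_preimage:
  assumes "coarse_control \<phi>"
  shows "\<exists>S. \<forall>t\<ge>0. \<phi> t \<le> R \<longrightarrow> t \<le> S"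
proof -
  have "\<forall>\<^sub>F t in at_top. R + 1 \<le> \<phi> t"
    using assms unfolding coarse_control_def filterlim_at_top by blast
  then obtain S where "\<And>t. t \<ge> S \<Longrightarrow> R + 1 \<le> \<phi> t"
    unfolding eventually_at_top_linorder by blast
  then have "\<forall>t\<ge>0. \<phi> t \<le> R \<longrightarrow> t \<le> S"
    by (smt (verit))
  then show ?thesis ..
qed

lemma coarsely_equivalent_metrics_iff:
  assumes b: "\<And>x y. x \<in> Z \<Longrightarrow> y \<in> Z \<Longrightarrow> 0 \<le> b x y"
    and d: "\<And>x y. x \<in> Z \<Longrightarrow> y \<in> Z \<Longrightarrow> 0 \<le> d x y"
  shows "coarsely_equivalent_metrics Z b d \<longleftrightarrow> bounded_control Z b d \<and> bounded_control Z d b"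
proof
  assume "coarsely_equivalent_metrics Z b d"
  then obtain \<phi> \<psi> where c: "coarse_control \<phi>" "coarse_control \<psi>"
    and bd: "\<And>x y. x \<in> Z \<Longrightarrow> y \<in> Z \<Longrightarrow> \<phi> (d x y) \<le> b x y \<and> b x y \<le> \<psi> (d x y)"
    unfolding coarsely_equivalent_metrics_def by blast
  \<comment> \<open>\<open>\<psi>\<close> is monotone only on the nonnegative reals, while
    \<open>R\<close> may be negative.\<close>
  have "b x y \<le> \<psi> (max 0 R)" if "x \<in> Z" "y \<in> Z" "d x y \<le> R" for x y R
  proof -
    have "\<psi> (d x y) \<le> \<psi> (max 0 R)"
      using c(2) d[OF that(1,2)] that(3) unfolding coarse_control_def
      by (auto elim!: mono_onD)
    with bd[OF that(1,2)] show ?thesis by linarith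
  qed
  then have "bounded_control Z b d"
    unfolding bounded_control_def by blast
  moreover have "bounded_control Z d b"
    unfolding bounded_control_def
  proof
    fix R
    obtain S where "\<And>t. t \<ge> 0 \<Longrightarrow> \<phi> t \<le> R \<Longrightarrow> t \<le> S"
      using coarse_control_bounded_preimage[OF c(1)] by blast
    then show "\<exists>S. \<forall>x\<in>Z. \<forall>y\<in>Z. b x y \<le> R \<longrightarrow> d x y \<le> S"
      using bd d by (meson order_trans)
  qed
  ultimately show "bounded_control Z b d \<and> bounded_control Z d b" ..
next
  assume "bounded_control Z b d \<and> bounded_control Z d b"
  then obtain \<phi> \<psi> where "coarse_control \<phi>" "coarse_control \<psi>"
    and "\<forall>x\<in>Z. \<forall>y\<in>Z. 0 \<le> d x y \<longrightarrow> \<phi> (d x y) \<le> b x y"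
    and "\<forall>x\<in>Z. \<forall>y\<in>Z. 0 \<le> d x y \<longrightarrow> b x y \<le> \<psi> (d x y)"
    using coarse_control_upper[of Z b d] coarse_control_lower[of Z d b, OF _ b] by fastforce
  then show "coarsely_equivalent_metrics Z b d"
    unfolding coarsely_equivalent_metrics_def using d
    by (intro exI[of _ \<phi>] exI[of _ \<psi>] conjI) auto
qed

section \<open>Metrics on the double\<close>

text \<open>Products, the unit and the metrics built later from a self-map all have this form, so
  one lemma, \<open>double_of_in_double_metrics\<close>, proves the metric axioms for all of
  them.\<close>

fun double_of :: "('a \<Rightarrow> 'a \<Rightarrow> real) \<Rightarrow> ('a \<Rightarrow> 'a \<Rightarrow> real) \<Rightarrow> 'a + 'a \<Rightarrow> 'a + 'a \<Rightarrow> real" where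
  "double_of dX g (Inl x) (Inl y) = dX x y"
| "double_of dX g (Inr x) (Inr y) = dX x y"
| "double_of dX g (Inl x) (Inr y) = g x y"
| "double_of dX g (Inr y) (Inl x) = g x y"

lemma double_comp_eq_double_of:
  "double_comp X dX \<rho> d = double_of dX (\<lambda>x z. INF y\<in>X. d (Inl x) (Inr y) + \<rho> (Inl y) (Inr z))"
proof (intro ext)
  fix p q
  show "double_comp X dX \<rho> d p q =
    double_of dX (\<lambda>x z. INF y\<in>X. d (Inl x) (Inr y) + \<rho> (Inl y) (Inr z)) p q"
    by (cases p; cases q) auto
qed

lemma double_unit_eq_double_of: "double_unit dX = double_of dX (\<lambda>x y. dX x y + 1)"
proof (intro ext)
  fix p q
  show "double_unit dX p q = double_of dX (\<lambda>x y. dX x y + 1) p q"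
    by (cases p; cases q) auto
qed

text \<open>All metrics in \<open>double_metrics\<close> agree inside each copy of \<open>X\<close>,
  so only distances between the copies need comparison.\<close>

definition cross_dominated ::
  "'a set \<Rightarrow> ('a + 'a \<Rightarrow> 'a + 'a \<Rightarrow> real) \<Rightarrow> ('a + 'a \<Rightarrow> 'a + 'a \<Rightarrow> real) \<Rightarrow> bool" where
  "cross_dominated X b d \<longleftrightarrow>
     (\<forall>R. \<exists>S. \<forall>x\<in>X. \<forall>y\<in>X. d (Inl x) (Inr y) \<le> R \<longrightarrow> b (Inl x) (Inr y) \<le> S)"

lemma cross_dominatedI:
  assumes "\<And>R x y. x \<in> X \<Longrightarrow> y \<in> X \<Longrightarrow> d (Inl x) (Inr y) \<le> R \<Longrightarrow> b (Inl x) (Inr y) \<le> S R"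
  shows "cross_dominated X b d"
  using assms unfolding cross_dominated_def by blast

lemma cross_dominated_refl: "cross_dominated X d d"
  unfolding cross_dominated_def by blast

lemma cross_dominated_trans:
  "cross_dominated X a b \<Longrightarrow> cross_dominated X b c \<Longrightarrow> cross_dominated X a c"
  unfolding cross_dominated_def by meson

text \<open>Nonemptiness makes each infimum over \<open>X\<close> that defines a product a genuine
  greatest lower bound.\<close>

locale nonempty_metric_space = Metric_space X dX for X :: "'a set" and dX +
  assumes nonempty: "X \<noteq> {}"
begin

abbreviation "DM \<equiv> double_metrics X dX"
abbreviation "CR \<equiv> double_coarse_rel X dX"
abbreviation "dcomp \<equiv> double_comp X dX"
abbreviation "S \<equiv> double_semigroup X dX"

section \<open>Triangle inequalities between the two copies\<close>

lemma double_metrics_base: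
  assumes "d \<in> DM" "x \<in> X" "y \<in> X"
  shows "d (Inl x) (Inl y) = dX x y" "d (Inr x) (Inr y) = dX x y"
  using assms unfolding double_metrics_def by auto

lemma double_metrics_metric: "d \<in> DM \<Longrightarrow> Metric_space (X <+> X) d"
  unfolding double_metrics_def by auto

lemma double_metrics_nonneg: "d \<in> DM \<Longrightarrow> 0 \<le> d p q"
  using double_metrics_metric Metric_space.nonneg by metis

lemma double_metrics_commute: "d \<in> DM \<Longrightarrow> d p q = d q p"
  using double_metrics_metric Metric_space.commute by metis

lemma double_metrics_triangle:
  assumes "d \<in> DM" "p \<in> X <+> X" "q \<in> X <+> X" "r \<in> X <+> X"
  shows "d p r \<le> d p q + d q r"
  using Metric_space.triangle[OF double_metrics_metric] assms by metis

text \<open>These are the triangle inequalities with vertices in both copies, written with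
  \<open>dX\<close> and distances from unprimed to primed points only. Later estimates work with
  them instead of with points of the double.\<close>

lemma cross_triangle:
  assumes d: "d \<in> DM" and x: "x \<in> X" and y: "y \<in> X" and z: "z \<in> X"
  shows "d (Inl x) (Inr y) \<le> dX x z + d (Inl z) (Inr y)"
    and "d (Inl x) (Inr y) \<le> d (Inl x) (Inr z) + dX z y"
    and "dX x y \<le> d (Inl x) (Inr z) + d (Inl y) (Inr z)"
    and "dX x y \<le> d (Inl z) (Inr x) + d (Inl z) (Inr y)"
proof -
  have tri: "d p r \<le> d p q + d q r" if "p \<in> X <+> X" "q \<in> X <+> X" "r \<in> X <+> X" for p q r
    using double_metrics_triangle[OF d that] .
  show "d (Inl x) (Inr y) \<le> dX x z + d (Inl z) (Inr y)"
    using tri[of "Inl x" "Inl z" "Inr y"] double_metrics_base[OF d] x y z by auto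
  show "d (Inl x) (Inr y) \<le> d (Inl x) (Inr z) + dX z y"
    using tri[of "Inl x" "Inr z" "Inr y"] double_metrics_base[OF d] x y z by auto
  show "dX x y \<le> d (Inl x) (Inr z) + d (Inl y) (Inr z)"
    using tri[of "Inl x" "Inr z" "Inl y"] double_metrics_base[OF d] x y z
      double_metrics_commute[OF d, of "Inr z" "Inl y"] by auto
  show "dX x y \<le> d (Inl z) (Inr x) + d (Inl z) (Inr y)"
    using tri[of "Inr x" "Inl z" "Inr y"] double_metrics_base[OF d] x y z
      double_metrics_commute[OF d, of "Inr x" "Inl z"] by auto
qed

lemma cross_positive:
  assumes "d \<in> DM"
  obtains \<delta> where "\<delta> > 0" "\<And>x y. x \<in> X \<Longrightarrow> y \<in> X \<Longrightarrow> \<delta> \<le> d (Inl x) (Inr y)"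
proof
  show "(INF (x, y)\<in>X \<times> X. d (Inl x) (Inr y)) > 0"
    using assms unfolding double_metrics_def by auto
  show "(INF (x, y)\<in>X \<times> X. d (Inl x) (Inr y)) \<le> d (Inl x) (Inr y)" if "x \<in> X" "y \<in> X" for x y
  proof -
    have "bdd_below ((\<lambda>(x, y). d (Inl x) (Inr y)) ` (X \<times> X))"
      by (rule bdd_belowI[of _ 0]) (use double_metrics_nonneg[OF assms] in auto)
    then show ?thesis
      using cINF_lower[of "\<lambda>(x, y). d (Inl x) (Inr y)" "X \<times> X" "(x, y)"] that by auto
  qed
qed

text \<open>Converse of \<open>cross_triangle\<close>: the four mixed inequalities, together with
  those of \<open>dX\<close>, cover every position of three points in the double up to symmetry. The
  bound \<delta> separates the copies and makes the infimum positive.\<close>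

lemma double_of_in_double_metrics:
  assumes nn: "\<And>x y. 0 \<le> g x y" and "\<delta> > 0" and \<delta>: "\<And>x y. x \<in> X \<Longrightarrow> y \<in> X \<Longrightarrow> \<delta> \<le> g x y"
    and tri: "\<And>x y z. x \<in> X \<Longrightarrow> y \<in> X \<Longrightarrow> z \<in> X \<Longrightarrow> g x y \<le> dX x z + g z y"
      "\<And>x y z. x \<in> X \<Longrightarrow> y \<in> X \<Longrightarrow> z \<in> X \<Longrightarrow> g x y \<le> g x z + dX z y"
      "\<And>x y z. x \<in> X \<Longrightarrow> y \<in> X \<Longrightarrow> z \<in> X \<Longrightarrow> dX x y \<le> g x z + g y z"
      "\<And>x y z. x \<in> X \<Longrightarrow> y \<in> X \<Longrightarrow> z \<in> X \<Longrightarrow> dX x y \<le> g z x + g z y"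
  shows "double_of dX g \<in> DM"
proof -
  have pos: "g x y > 0" if "x \<in> X" "y \<in> X" for x y
    using \<delta>[OF that] \<open>\<delta> > 0\<close> by linarith
  have "Metric_space (X <+> X) (double_of dX g)"
  proof
    fix p q r
    show "0 \<le> double_of dX g p q"
      by (cases p; cases q) (auto simp: nn)
    show "double_of dX g p q = double_of dX g q p"
      by (cases p; cases q) (auto simp: commute)
    assume p: "p \<in> X <+> X" and q: "q \<in> X <+> X"
    show "(double_of dX g p q = 0) = (p = q)"
      using p q pos by (cases p; cases q) (auto simp: less_le)
    assume r: "r \<in> X <+> X"
    show "double_of dX g p r \<le> double_of dX g p q + double_of dX g q r"
    proof (cases p; cases q; cases r)
      fix x y z assume "p = Inl x" "q = Inr y" "r = Inr z"
      then show ?thesis using tri(2) p q r by auto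
    next
      fix x y z assume "p = Inr x" "q = Inl y" "r = Inl z"
      then show ?thesis using tri(1)[of z x y] p q r commute[of z y] by auto
    next
      fix x y z assume "p = Inr x" "q = Inr y" "r = Inl z"
      then show ?thesis using tri(2)[of z x y] p q r commute[of x y] by auto
    qed (use p q r tri triangle in auto)
  qed
  moreover have "(INF (x, y)\<in>X \<times> X. double_of dX g (Inl x) (Inr y)) > 0"
  proof -
    have "\<delta> \<le> (INF (x, y)\<in>X \<times> X. g x y)"
      by (rule cINF_greatest) (use nonempty \<delta> in auto)
    with \<open>\<delta> > 0\<close> show ?thesis by auto
  qed
  ultimately show ?thesis
    unfolding double_metrics_def by auto
qed

section \<open>Coarse classes in terms of cross distances\<close>

lemma coarse_rel_iff:
  "(b, d) \<in> CR \<longleftrightarrow> b \<in> DM \<and> d \<in> DM \<and> cross_dominated X b d \<and> cross_dominated X d b"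
proof -
  have control_iff: "bounded_control (X <+> X) b d \<longleftrightarrow> cross_dominated X b d"
    if b: "b \<in> DM" and d: "d \<in> DM" for b d
  proof
    assume L: "bounded_control (X <+> X) b d"
    show "cross_dominated X b d"
      unfolding cross_dominated_def
    proof
      fix R
      obtain S where "\<forall>p\<in>X <+> X. \<forall>q\<in>X <+> X. d p q \<le> R \<longrightarrow> b p q \<le> S"
        using L unfolding bounded_control_def by blast
      then show "\<exists>S. \<forall>x\<in>X. \<forall>y\<in>X. d (Inl x) (Inr y) \<le> R \<longrightarrow> b (Inl x) (Inr y) \<le> S"
        by (intro exI[of _ S]) auto
    qed
  next
    assume L: "cross_dominated X b d"
    show "bounded_control (X <+> X) b d"
      unfolding bounded_control_def
    proof
      fix R
      obtain S where S: "\<And>x y. x \<in> X \<Longrightarrow> y \<in> X \<Longrightarrow> d (Inl x) (Inr y) \<le> R \<Longrightarrow> b (Inl x) (Inr y) \<le> S"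
        using L unfolding cross_dominated_def by blast
      \<comment> \<open>\<open>R\<close> serves pairs in the same copy, where \<open>b\<close> and
        \<open>d\<close> coincide; \<open>S\<close> serves pairs in different copies.\<close>
      have "b p q \<le> max R S" if "p \<in> X <+> X" "q \<in> X <+> X" "d p q \<le> R" for p q
        using that double_metrics_base[OF b] double_metrics_base[OF d] S
          double_metrics_commute[OF b, of "Inr _" "Inl _"]
          double_metrics_commute[OF d, of "Inr _" "Inl _"]
        by (cases p; cases q) (fastforce simp: le_max_iff_disj)+
      then show "\<exists>S. \<forall>x\<in>X <+> X. \<forall>y\<in>X <+> X. d x y \<le> R \<longrightarrow> b x y \<le> S"
        by blast
    qed
  qed
  have "coarsely_equivalent_metrics (X <+> X) b d \<longleftrightarrow>
    cross_dominated X b d \<and> cross_dominated X d b" if "b \<in> DM" "d \<in> DM"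
  proof -
    have "coarsely_equivalent_metrics (X <+> X) b d \<longleftrightarrow>
      bounded_control (X <+> X) b d \<and> bounded_control (X <+> X) d b"
      by (rule coarsely_equivalent_metrics_iff) (rule double_metrics_nonneg, rule that)+
    then show ?thesis using control_iff that by simp
  qed
  then show ?thesis
    unfolding double_coarse_rel_def by simp blast
qed

lemma equiv_coarse_rel: "equiv DM CR"
proof (rule equivI)
  show "CR \<subseteq> DM \<times> DM" by (auto simp: coarse_rel_iff)
  show "refl_on DM CR" by (auto simp: refl_on_def coarse_rel_iff cross_dominated_refl)
  show "sym CR" by (auto simp: sym_def coarse_rel_iff)
  show "trans CR" by (auto simp: trans_def coarse_rel_iff intro: cross_dominated_trans)
qed

section \<open>The monoid structure\<close>

lemma comp_le:
  assumes "\<rho> \<in> DM" "d \<in> DM" "y \<in> X"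
  shows "dcomp \<rho> d (Inl x) (Inr z) \<le> d (Inl x) (Inr y) + \<rho> (Inl y) (Inr z)"
proof -
  have "bdd_below ((\<lambda>y. d (Inl x) (Inr y) + \<rho> (Inl y) (Inr z)) ` X)"
    by (rule bdd_belowI[of _ 0]) (use double_metrics_nonneg assms in auto)
  then show ?thesis
    using cINF_lower[OF _ assms(3)] by simp
qed

lemma comp_approx:
  assumes "dcomp \<rho> d (Inl x) (Inr z) < R"
  obtains y where "y \<in> X" "d (Inl x) (Inr y) + \<rho> (Inl y) (Inr z) < R"
proof -
  have "\<exists>y\<in>X. d (Inl x) (Inr y) + \<rho> (Inl y) (Inr z) < R"
  proof (rule ccontr)
    assume "\<not> ?thesis"
    then have "R \<le> (INF y\<in>X. d (Inl x) (Inr y) + \<rho> (Inl y) (Inr z))"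
      by (intro cINF_greatest nonempty) (auto simp: not_less)
    with assms show False by simp
  qed
  then show ?thesis using that by blast
qed

text \<open>The infimum need not be attained, so a point is taken within 1 of it. Both summands are
  nonnegative, hence each inherits the bound. The loss of 1 is invisible to coarse
  equivalence.\<close>

lemma comp_le_imp_near:
  assumes "\<rho> \<in> DM" "d \<in> DM" "dcomp \<rho> d (Inl x) (Inr z) \<le> R"
  obtains y where "y \<in> X" "d (Inl x) (Inr y) \<le> R + 1" "\<rho> (Inl y) (Inr z) \<le> R + 1"
proof -
  obtain y where "y \<in> X" "d (Inl x) (Inr y) + \<rho> (Inl y) (Inr z) < R + 1"
    by (rule comp_approx[of \<rho> d x z "R + 1"]) (use assms(3) in \<open>simp del: double_comp.simps\<close>)
  moreover have "0 \<le> \<rho> (Inl y) (Inr z)" "0 \<le> d (Inl x) (Inr y)"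
    using double_metrics_nonneg assms(1,2) by auto
  ultimately have "d (Inl x) (Inr y) \<le> R + 1" "\<rho> (Inl y) (Inr z) \<le> R + 1"
    by linarith+
  with \<open>y \<in> X\<close> show ?thesis by (rule that)
qed

lemma comp_greatest:
  assumes "\<And>y. y \<in> X \<Longrightarrow> c \<le> d (Inl x) (Inr y) + \<rho> (Inl y) (Inr z)"
  shows "c \<le> dcomp \<rho> d (Inl x) (Inr z)"
  using assms by (simp add: cINF_greatest nonempty)

lemma comp_in_double_metrics:
  assumes \<rho>: "\<rho> \<in> DM" and d: "d \<in> DM"
  shows "dcomp \<rho> d \<in> DM"
proof -
  obtain \<delta> where \<delta>: "\<delta> > 0" "\<And>x y. x \<in> X \<Longrightarrow> y \<in> X \<Longrightarrow> \<delta> \<le> d (Inl x) (Inr y)"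
    using cross_positive[OF d] by blast
  define g where "g x z = dcomp \<rho> d (Inl x) (Inr z)" for x z
  have eq: "dcomp \<rho> d = double_of dX g"
    unfolding g_def double_comp_eq_double_of by simp
  have nn: "0 \<le> \<rho> p q" "0 \<le> d p q" for p q
    using double_metrics_nonneg \<rho> d by auto
  \<comment> \<open>Lower bound for a sum of two infima with independent intermediate points: one
    summand is moved to the other side at a time.\<close>
  have two: "c \<le> g x z + g x' z'"
    if "\<And>y y'. y \<in> X \<Longrightarrow> y' \<in> X \<Longrightarrow> c \<le> (d (Inl x) (Inr y) + \<rho> (Inl y) (Inr z))
      + (d (Inl x') (Inr y') + \<rho> (Inl y') (Inr z'))" for c x z x' z'
  proof -
    have "c - g x' z' \<le> g x z"
      unfolding g_def
    proof (rule comp_greatest)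
      fix y assume "y \<in> X"
      have "c - (d (Inl x) (Inr y) + \<rho> (Inl y) (Inr z)) \<le> dcomp \<rho> d (Inl x') (Inr z')"
        by (rule comp_greatest) (use that[OF \<open>y \<in> X\<close>] in fastforce)
      then show "c - dcomp \<rho> d (Inl x') (Inr z') \<le> d (Inl x) (Inr y) + \<rho> (Inl y) (Inr z)"
        by simp
    qed
    then show ?thesis by simp
  qed
  show ?thesis
    unfolding eq
  proof (rule double_of_in_double_metrics[OF _ \<delta>(1)])
    fix x y z
    show "0 \<le> g x y"
      unfolding g_def by (rule comp_greatest) (simp add: nn)
    assume x: "x \<in> X" and y: "y \<in> X"
    show "\<delta> \<le> g x y"
      \<comment> \<open>The lower bound of \<open>d\<close> alone suffices, since \<rho> is
        nonnegative.\<close>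
      unfolding g_def by (rule comp_greatest) (use \<delta>(2)[OF x] nn in \<open>simp add: add_increasing2\<close>)
    assume z: "z \<in> X"
    have "g x y - dX x z \<le> g z y"
      unfolding g_def
    proof (rule comp_greatest)
      fix w assume w: "w \<in> X"
      show "dcomp \<rho> d (Inl x) (Inr y) - dX x z \<le> d (Inl z) (Inr w) + \<rho> (Inl w) (Inr y)"
        using comp_le[OF \<rho> d w, of x y] cross_triangle(1)[OF d x w z] by linarith
    qed
    then show "g x y \<le> dX x z + g z y" by simp
    have "g x y - dX z y \<le> g x z"
      unfolding g_def
    proof (rule comp_greatest)
      fix w assume w: "w \<in> X"
      show "dcomp \<rho> d (Inl x) (Inr y) - dX z y \<le> d (Inl x) (Inr w) + \<rho> (Inl w) (Inr z)"
        using comp_le[OF \<rho> d w, of x y] cross_triangle(2)[OF \<rho> w y z] by linarith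
    qed
    then show "g x y \<le> g x z + dX z y" by simp
    \<comment> \<open>The routes from \<open>x\<close> and \<open>y\<close> to the primed
      \<open>z\<close> pass through \<open>v\<close> and \<open>w\<close>. Since \<rho> bounds
      \<open>dX v w\<close>, the route from \<open>x\<close> can be redirected to \<open>w\<close>
      and meets the one from \<open>y\<close> there. The next inequality is the mirror
      image.\<close>
    show "dX x y \<le> g x z + g y z"
    proof (rule two)
      fix v w assume v: "v \<in> X" and w: "w \<in> X"
      show "dX x y \<le> d (Inl x) (Inr v) + \<rho> (Inl v) (Inr z) + (d (Inl y) (Inr w) + \<rho> (Inl w) (Inr z))"
        using cross_triangle(3)[OF d x y w] cross_triangle(2)[OF d x w v]
          cross_triangle(3)[OF \<rho> v w z] by linarith
    qed
    show "dX x y \<le> g z x + g z y"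
    proof (rule two)
      fix v w assume v: "v \<in> X" and w: "w \<in> X"
      show "dX x y \<le> d (Inl z) (Inr v) + \<rho> (Inl v) (Inr x) + (d (Inl z) (Inr w) + \<rho> (Inl w) (Inr y))"
        using cross_triangle(4)[OF \<rho> x y w] cross_triangle(1)[OF \<rho> w x v]
          cross_triangle(4)[OF d v w z] commute[of v w] by linarith
    qed
  qed
qed

lemma unit_in_double_metrics: "double_unit dX \<in> DM"
  unfolding double_unit_eq_double_of
proof (rule double_of_in_double_metrics[of _ 1])
  fix x y z assume x: "x \<in> X" and y: "y \<in> X" and z: "z \<in> X"
  show "dX x y + 1 \<le> dX x z + (dX z y + 1)"
    using triangle[OF x z y] by simp
  show "dX x y + 1 \<le> dX x z + 1 + dX z y"
    using triangle[OF x z y] by simp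
  show "dX x y \<le> dX x z + 1 + (dX y z + 1)"
    using triangle[OF x z y] commute[of y z] by simp
  show "dX x y \<le> dX z x + 1 + (dX z y + 1)"
    using triangle[OF x z y] commute[of x z] by simp
qed (auto simp: add_increasing2)

text \<open>A nearly optimal intermediate point for the dominating pair is also an intermediate
  point of controlled cost for the dominated pair.\<close>

lemma comp_cross_dominated:
  assumes DM: "\<rho>' \<in> DM" "d' \<in> DM" "\<rho> \<in> DM" "d \<in> DM"
    and \<rho>: "cross_dominated X \<rho>' \<rho>" and d: "cross_dominated X d' d"
  shows "cross_dominated X (dcomp \<rho>' d') (dcomp \<rho> d)"
  unfolding cross_dominated_def
proof
  fix R
  obtain P where P: "\<And>x y. x \<in> X \<Longrightarrow> y \<in> X \<Longrightarrow> \<rho> (Inl x) (Inr y) \<le> R + 1 \<Longrightarrow> \<rho>' (Inl x) (Inr y) \<le> P"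
    using \<rho> unfolding cross_dominated_def by blast
  obtain D where D: "\<And>x y. x \<in> X \<Longrightarrow> y \<in> X \<Longrightarrow> d (Inl x) (Inr y) \<le> R + 1 \<Longrightarrow> d' (Inl x) (Inr y) \<le> D"
    using d unfolding cross_dominated_def by blast
  have "dcomp \<rho>' d' (Inl x) (Inr z) \<le> D + P"
    if x: "x \<in> X" and z: "z \<in> X" and R: "dcomp \<rho> d (Inl x) (Inr z) \<le> R" for x z
  proof -
    obtain y where y: "y \<in> X" "d (Inl x) (Inr y) \<le> R + 1" "\<rho> (Inl y) (Inr z) \<le> R + 1"
      by (rule comp_le_imp_near[OF DM(3,4) R])
    show ?thesis
      using comp_le[OF DM(1,2) y(1), of x z] D[OF x y(1,2)] P[OF y(1) z y(3)] by linarith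
  qed
  then show "\<exists>S. \<forall>x\<in>X. \<forall>y\<in>X. dcomp \<rho> d (Inl x) (Inr y) \<le> R \<longrightarrow> dcomp \<rho>' d' (Inl x) (Inr y) \<le> S"
    by blast
qed

section \<open>Multiplication of classes and the monoid laws\<close>

text \<open>The product is a union over all representatives; by congruence all the sets united are
  the same class, so one choice of representatives computes it.\<close>

lemma mult_class:
  assumes "\<rho> \<in> DM" "d \<in> DM"
  shows "CR `` {\<rho>} \<otimes>\<^bsub>S\<^esub> CR `` {d} = CR `` {dcomp \<rho> d}"
proof -
  have "congruent2 CR CR (\<lambda>\<rho> d. CR `` {dcomp \<rho> d})"
  proof (rule congruent2I')
    fix \<rho> \<rho>' d d' assume "(\<rho>, \<rho>') \<in> CR" "(d, d') \<in> CR"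
    then have "(dcomp \<rho> d, dcomp \<rho>' d') \<in> CR"
      unfolding coarse_rel_iff by (simp add: comp_in_double_metrics comp_cross_dominated)
    then show "CR `` {dcomp \<rho> d} = CR `` {dcomp \<rho>' d'}"
      by (rule equiv_class_eq[OF equiv_coarse_rel])
  qed
  then show ?thesis
    unfolding double_semigroup_def
    by (simp add: UN_equiv_class2[OF equiv_coarse_rel equiv_coarse_rel] assms)
qed

lemma class_eq_iff:
  assumes "b \<in> DM" "d \<in> DM"
  shows "CR `` {b} = CR `` {d} \<longleftrightarrow> cross_dominated X b d \<and> cross_dominated X d b"
  using eq_equiv_class_iff[OF equiv_coarse_rel assms] assms by (simp add: coarse_rel_iff)

lemma carrier_eq: "carrier S = (\<lambda>d. CR `` {d}) ` DM"
  unfolding double_semigroup_def quotient_def by auto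

lemma one_eq: "\<one>\<^bsub>S\<^esub> = CR `` {double_unit dX}"
  unfolding double_semigroup_def by simp

text \<open>Either bracketing measures routes through the same two intermediate points; taking one
  apart and reassembling it the other way changes the bound in a controlled manner.\<close>

lemma comp_assoc_dominated:
  assumes \<rho>: "\<rho> \<in> DM" and \<sigma>: "\<sigma> \<in> DM" and d: "d \<in> DM"
  shows "cross_dominated X (dcomp (dcomp \<rho> \<sigma>) d) (dcomp \<rho> (dcomp \<sigma> d))"
    and "cross_dominated X (dcomp \<rho> (dcomp \<sigma> d)) (dcomp (dcomp \<rho> \<sigma>) d)"
proof -
  note \<rho>\<sigma> = comp_in_double_metrics[OF \<rho> \<sigma>] and \<sigma>d = comp_in_double_metrics[OF \<sigma> d]
  show "cross_dominated X (dcomp (dcomp \<rho> \<sigma>) d) (dcomp \<rho> (dcomp \<sigma> d))"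
  proof (rule cross_dominatedI)
    fix R x z assume "dcomp \<rho> (dcomp \<sigma> d) (Inl x) (Inr z) \<le> R"
    then obtain y where y: "y \<in> X" "dcomp \<sigma> d (Inl x) (Inr y) \<le> R + 1" "\<rho> (Inl y) (Inr z) \<le> R + 1"
      by (rule comp_le_imp_near[OF \<rho> \<sigma>d])
    from y(2) obtain w where w: "w \<in> X" "d (Inl x) (Inr w) \<le> R + 1 + 1" "\<sigma> (Inl w) (Inr y) \<le> R + 1 + 1"
      by (rule comp_le_imp_near[OF \<sigma> d])
    \<comment> \<open>The three legs cost at most \<open>R + 2\<close>, \<open>R + 2\<close> and
      \<open>R + 1\<close>, as two of them come from unpacking twice.\<close>
    show "dcomp (dcomp \<rho> \<sigma>) d (Inl x) (Inr z) \<le> 3 * R + 5"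
      using comp_le[OF \<rho>\<sigma> d w(1), of x z] comp_le[OF \<rho> \<sigma> y(1), of w z] y w by linarith
  qed
  show "cross_dominated X (dcomp \<rho> (dcomp \<sigma> d)) (dcomp (dcomp \<rho> \<sigma>) d)"
  proof (rule cross_dominatedI)
    fix R x z assume "dcomp (dcomp \<rho> \<sigma>) d (Inl x) (Inr z) \<le> R"
    then obtain w where w: "w \<in> X" "d (Inl x) (Inr w) \<le> R + 1" "dcomp \<rho> \<sigma> (Inl w) (Inr z) \<le> R + 1"
      by (rule comp_le_imp_near[OF \<rho>\<sigma> d])
    from w(3) obtain y where y: "y \<in> X" "\<sigma> (Inl w) (Inr y) \<le> R + 1 + 1" "\<rho> (Inl y) (Inr z) \<le> R + 1 + 1"
      by (rule comp_le_imp_near[OF \<rho> \<sigma>])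
    show "dcomp \<rho> (dcomp \<sigma> d) (Inl x) (Inr z) \<le> 3 * R + 5"
      using comp_le[OF \<rho> \<sigma>d y(1), of x z] comp_le[OF \<sigma> d w(1), of x y] y w by linarith
  qed
qed

lemma comp_unit_right:
  assumes d: "d \<in> DM"
  shows "CR `` {dcomp d (double_unit dX)} = CR `` {d}"
proof -
  note u = unit_in_double_metrics
  have "cross_dominated X (dcomp d (double_unit dX)) d"
  proof (rule cross_dominatedI)
    fix R x z assume x: "x \<in> X" and "d (Inl x) (Inr z) \<le> R"
    then show "dcomp d (double_unit dX) (Inl x) (Inr z) \<le> R + 1"
      using comp_le[OF d u x, of x z] by simp
  qed
  moreover have "cross_dominated X d (dcomp d (double_unit dX))"
  proof (rule cross_dominatedI)
    fix R x z assume x: "x \<in> X" and z: "z \<in> X" and R: "dcomp d (double_unit dX) (Inl x) (Inr z) \<le> R"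
    obtain y where "y \<in> X" "double_unit dX (Inl x) (Inr y) \<le> R + 1" "d (Inl y) (Inr z) \<le> R + 1"
      by (rule comp_le_imp_near[OF d u R])
    \<comment> \<open>The bound on the unit gives \<open>dX x y \<le> R\<close>, its summand 1
      absorbing the slack; the other leg contributes \<open>R + 1\<close>.\<close>
    then show "d (Inl x) (Inr z) \<le> 2 * R + 1"
      using cross_triangle(1)[OF d x z, of y] by simp
  qed
  ultimately show ?thesis
    using class_eq_iff comp_in_double_metrics d u by blast
qed

lemma comp_unit_left:
  assumes d: "d \<in> DM"
  shows "CR `` {dcomp (double_unit dX) d} = CR `` {d}"
proof -
  note u = unit_in_double_metrics
  have "cross_dominated X (dcomp (double_unit dX) d) d"
  proof (rule cross_dominatedI)
    fix R x z assume z: "z \<in> X" and "d (Inl x) (Inr z) \<le> R"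
    then show "dcomp (double_unit dX) d (Inl x) (Inr z) \<le> R + 1"
      using comp_le[OF u d z, of x z] by simp
  qed
  moreover have "cross_dominated X d (dcomp (double_unit dX) d)"
  proof (rule cross_dominatedI)
    fix R x z assume x: "x \<in> X" and z: "z \<in> X" and R: "dcomp (double_unit dX) d (Inl x) (Inr z) \<le> R"
    obtain y where "y \<in> X" "d (Inl x) (Inr y) \<le> R + 1" "double_unit dX (Inl y) (Inr z) \<le> R + 1"
      by (rule comp_le_imp_near[OF u d R])
    then show "d (Inl x) (Inr z) \<le> 2 * R + 1"
      using cross_triangle(2)[OF d x z, of y] by simp
  qed
  ultimately show ?thesis
    using class_eq_iff comp_in_double_metrics d u by blast
qed

lemma monoid_double_semigroup: "monoid S"
proof (rule monoidI)
  show "\<one>\<^bsub>S\<^esub> \<in> carrier S"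
    by (auto simp: carrier_eq one_eq unit_in_double_metrics)
  fix A B C assume "A \<in> carrier S"
  then obtain a where a: "a \<in> DM" "A = CR `` {a}" by (auto simp: carrier_eq)
  show "\<one>\<^bsub>S\<^esub> \<otimes>\<^bsub>S\<^esub> A = A" "A \<otimes>\<^bsub>S\<^esub> \<one>\<^bsub>S\<^esub> = A"
    using a by (simp_all add: one_eq mult_class unit_in_double_metrics comp_unit_left comp_unit_right)
  assume "B \<in> carrier S"
  then obtain b where b: "b \<in> DM" "B = CR `` {b}" by (auto simp: carrier_eq)
  show "A \<otimes>\<^bsub>S\<^esub> B \<in> carrier S"
    using a b by (simp add: mult_class carrier_eq comp_in_double_metrics)
  assume "C \<in> carrier S"
  then obtain c where c: "c \<in> DM" "C = CR `` {c}" by (auto simp: carrier_eq)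
  show "A \<otimes>\<^bsub>S\<^esub> B \<otimes>\<^bsub>S\<^esub> C = A \<otimes>\<^bsub>S\<^esub> (B \<otimes>\<^bsub>S\<^esub> C)"
    using a b c comp_assoc_dominated[OF a(1) b(1) c(1)]
    by (simp add: mult_class comp_in_double_metrics class_eq_iff)
qed

section \<open>Products equal to the unit\<close>

text \<open>If \<open>d\<close> is at most \<open>K\<close> on the diagonal, then the distance from
  \<open>x\<close> to the primed \<open>y\<close> differs from \<open>dX x y\<close> by at most
  \<open>K\<close>, by the triangle inequality through the other copy of \<open>y\<close>.\<close>

lemma class_eq_one_iff:
  assumes d: "d \<in> DM"
  shows "CR `` {d} = \<one>\<^bsub>S\<^esub> \<longleftrightarrow> (\<exists>K. \<forall>x\<in>X. d (Inl x) (Inr x) \<le> K)"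
proof
  assume "CR `` {d} = \<one>\<^bsub>S\<^esub>"
  then have "cross_dominated X d (double_unit dX)"
    by (simp add: one_eq class_eq_iff d unit_in_double_metrics)
  \<comment> \<open>The radius 1 is the value of the unit metric on the diagonal.\<close>
  then obtain K where "\<forall>x\<in>X. \<forall>y\<in>X. double_unit dX (Inl x) (Inr y) \<le> 1 \<longrightarrow> d (Inl x) (Inr y) \<le> K"
    unfolding cross_dominated_def by blast
  then show "\<exists>K. \<forall>x\<in>X. d (Inl x) (Inr x) \<le> K"
    by (intro exI[of _ K]) simp
next
  assume "\<exists>K. \<forall>x\<in>X. d (Inl x) (Inr x) \<le> K"
  then obtain K where K: "\<And>x. x \<in> X \<Longrightarrow> d (Inl x) (Inr x) \<le> K" by blast
  have "cross_dominated X d (double_unit dX)"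
  proof (rule cross_dominatedI)
    fix R x y assume "x \<in> X" "y \<in> X" "double_unit dX (Inl x) (Inr y) \<le> R"
    then show "d (Inl x) (Inr y) \<le> R + K"
      using cross_triangle(1)[OF d, of x y y] K[of y] by simp
  qed
  moreover have "cross_dominated X (double_unit dX) d"
  proof (rule cross_dominatedI)
    fix R x y assume "x \<in> X" "y \<in> X" "d (Inl x) (Inr y) \<le> R"
    then show "double_unit dX (Inl x) (Inr y) \<le> R + K + 1"
      using cross_triangle(3)[OF d, of x y y] K[of y] by simp
  qed
  ultimately show "CR `` {d} = \<one>\<^bsub>S\<^esub>"
    by (simp add: one_eq class_eq_iff d unit_in_double_metrics)
qed

text \<open>The diagonal criterion applied to a product. A choice of \<open>y\<close> for each
  \<open>x\<close> turns a one-sided inverse into a self-map of \<open>X\<close>.\<close>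

lemma mult_eq_one_iff:
  assumes a: "a \<in> DM" and b: "b \<in> DM"
  shows "CR `` {a} \<otimes>\<^bsub>S\<^esub> CR `` {b} = \<one>\<^bsub>S\<^esub> \<longleftrightarrow>
    (\<exists>K. \<forall>x\<in>X. \<exists>y\<in>X. b (Inl x) (Inr y) \<le> K \<and> a (Inl y) (Inr x) \<le> K)"
proof -
  have "(\<exists>K. \<forall>x\<in>X. dcomp a b (Inl x) (Inr x) \<le> K) \<longleftrightarrow>
    (\<exists>K. \<forall>x\<in>X. \<exists>y\<in>X. b (Inl x) (Inr y) \<le> K \<and> a (Inl y) (Inr x) \<le> K)"
  proof
    assume "\<exists>K. \<forall>x\<in>X. dcomp a b (Inl x) (Inr x) \<le> K"
    then obtain K where K: "\<forall>x\<in>X. dcomp a b (Inl x) (Inr x) \<le> K" ..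
    have "\<exists>y\<in>X. b (Inl x) (Inr y) \<le> K + 1 \<and> a (Inl y) (Inr x) \<le> K + 1" if "x \<in> X" for x
      by (rule comp_le_imp_near[OF a b K[rule_format, OF that]]) blast
    then show "\<exists>K. \<forall>x\<in>X. \<exists>y\<in>X. b (Inl x) (Inr y) \<le> K \<and> a (Inl y) (Inr x) \<le> K"
      by blast
  next
    assume "\<exists>K. \<forall>x\<in>X. \<exists>y\<in>X. b (Inl x) (Inr y) \<le> K \<and> a (Inl y) (Inr x) \<le> K"
    then obtain K where K: "\<forall>x\<in>X. \<exists>y\<in>X. b (Inl x) (Inr y) \<le> K \<and> a (Inl y) (Inr x) \<le> K" ..
    have "dcomp a b (Inl x) (Inr x) \<le> K + K" if "x \<in> X" for x
      using comp_le[OF a b] K that by (meson add_mono order_trans)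
    then show "\<exists>K. \<forall>x\<in>X. dcomp a b (Inl x) (Inr x) \<le> K" by blast
  qed
  then show ?thesis
    by (simp add: mult_class a b class_eq_one_iff comp_in_double_metrics)
qed

section \<open>Weak finiteness and rough isometries\<close>

text \<open>If \<open>s\<close> times \<open>t\<close> is the unit, then \<open>t\<close> times
  \<open>s\<close> is an idempotent below the unit, and \<open>s\<close>, \<open>t\<close> are
  mutually pseudo-inverse, so it is equivalent to the unit. Conversely, an equivalence between the
  unit and a different idempotent is such a pair.\<close>

lemma weakly_finite_iff_directly_finite:
  "weakly_finite S \<longleftrightarrow>
    (\<forall>s\<in>carrier S. \<forall>t\<in>carrier S. s \<otimes>\<^bsub>S\<^esub> t = \<one>\<^bsub>S\<^esub> \<longrightarrow> t \<otimes>\<^bsub>S\<^esub> s = \<one>\<^bsub>S\<^esub>)"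
proof -
  interpret S: monoid S by (rule monoid_double_semigroup)
  have "infinite_idempotent S \<one>\<^bsub>S\<^esub> \<longleftrightarrow>
    (\<exists>s\<in>carrier S. \<exists>t\<in>carrier S. s \<otimes>\<^bsub>S\<^esub> t = \<one>\<^bsub>S\<^esub> \<and> t \<otimes>\<^bsub>S\<^esub> s \<noteq> \<one>\<^bsub>S\<^esub>)"
  proof
    assume "infinite_idempotent S \<one>\<^bsub>S\<^esub>"
    then show "\<exists>s\<in>carrier S. \<exists>t\<in>carrier S. s \<otimes>\<^bsub>S\<^esub> t = \<one>\<^bsub>S\<^esub> \<and> t \<otimes>\<^bsub>S\<^esub> s \<noteq> \<one>\<^bsub>S\<^esub>"
      unfolding infinite_idempotent_def idempotent_equiv_def pseudo_inverse_def by blast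
  next
    assume "\<exists>s\<in>carrier S. \<exists>t\<in>carrier S. s \<otimes>\<^bsub>S\<^esub> t = \<one>\<^bsub>S\<^esub> \<and> t \<otimes>\<^bsub>S\<^esub> s \<noteq> \<one>\<^bsub>S\<^esub>"
    then obtain s t where st: "s \<in> carrier S" "t \<in> carrier S"
      "s \<otimes>\<^bsub>S\<^esub> t = \<one>\<^bsub>S\<^esub>" "t \<otimes>\<^bsub>S\<^esub> s \<noteq> \<one>\<^bsub>S\<^esub>" by blast
    have tst: "t \<otimes>\<^bsub>S\<^esub> s \<otimes>\<^bsub>S\<^esub> t = t"
      using st by (simp add: S.m_assoc)
    then have "t \<otimes>\<^bsub>S\<^esub> s \<otimes>\<^bsub>S\<^esub> (t \<otimes>\<^bsub>S\<^esub> s) = t \<otimes>\<^bsub>S\<^esub> s"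
      using st by (metis S.m_assoc S.m_closed)
    with st tst show "infinite_idempotent S \<one>\<^bsub>S\<^esub>"
      unfolding infinite_idempotent_def idempotents_def idempotent_le_def idempotent_equiv_def
        pseudo_inverse_def
      by (intro conjI bexI[of _ "t \<otimes>\<^bsub>S\<^esub> s"] exI[of _ s] exI[of _ t]) auto
  qed
  then show ?thesis
    unfolding weakly_finite_def finite_idempotent_def idempotents_def
    using S.monoid_axioms by auto
qed

lemma weakly_finiteI:
  assumes dense: "\<And>f C. f \<in> X \<rightarrow> X \<Longrightarrow>
      (\<And>x y. x \<in> X \<Longrightarrow> y \<in> X \<Longrightarrow> \<bar>dX (f x) (f y) - dX x y\<bar> \<le> C) \<Longrightarrow>
      \<exists>D. \<forall>y\<in>X. \<exists>x\<in>X. dX (f x) y \<le> D"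
  shows "weakly_finite S"
  unfolding weakly_finite_iff_directly_finite
proof (intro ballI impI)
  fix s t assume "s \<in> carrier S" "t \<in> carrier S" and st: "s \<otimes>\<^bsub>S\<^esub> t = \<one>\<^bsub>S\<^esub>"
  then obtain a b where a: "a \<in> DM" "s = CR `` {a}" and b: "b \<in> DM" "t = CR `` {b}"
    by (auto simp: carrier_eq)
  obtain K where "\<forall>x\<in>X. \<exists>y\<in>X. b (Inl x) (Inr y) \<le> K \<and> a (Inl y) (Inr x) \<le> K"
    using st mult_eq_one_iff[OF a(1) b(1)] a b by auto
  then obtain f where f: "\<And>x. x \<in> X \<Longrightarrow> f x \<in> X" "\<And>x. x \<in> X \<Longrightarrow> b (Inl x) (Inr (f x)) \<le> K"
    "\<And>x. x \<in> X \<Longrightarrow> a (Inl (f x)) (Inr x) \<le> K"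
    by metis
  \<comment> \<open>In the metric \<open>b\<close> each point is within \<open>K\<close> of the
    primed copy of its image, so moving two points across costs at most
    \<open>2 * K\<close>.\<close>
  have "\<bar>dX (f x) (f y) - dX x y\<bar> \<le> 2 * K" if "x \<in> X" "y \<in> X" for x y
    using cross_triangle(3)[OF b(1) that f(1)[OF that(1)]]
      cross_triangle(2)[OF b(1) that(2) f(1)[OF that(1)] f(1)[OF that(2)]]
      cross_triangle(4)[OF b(1) f(1)[OF that(1)] f(1)[OF that(2)] that(1)]
      cross_triangle(1)[OF b(1) that(1) f(1)[OF that(2)] that(2)]
      f(2)[OF that(1)] f(2)[OF that(2)] commute[of "f x" "f y"] commute[of x y]
    by linarith
  then obtain D where D: "\<forall>y\<in>X. \<exists>x\<in>X. dX (f x) y \<le> D"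
    using dense[of f "2 * K"] f(1) by blast
  \<comment> \<open>A point \<open>z\<close> whose image is within \<open>D\<close> of
    \<open>y\<close> is the intermediate point for the reversed product.\<close>
  have "\<exists>z\<in>X. a (Inl y) (Inr z) \<le> D + K \<and> b (Inl z) (Inr y) \<le> D + K" if y: "y \<in> X" for y
  proof -
    obtain z where z: "z \<in> X" "dX (f z) y \<le> D" using D y by blast
    show ?thesis
      using cross_triangle(1)[OF a(1) y z(1) f(1)[OF z(1)]]
        cross_triangle(2)[OF b(1) z(1) y f(1)[OF z(1)]] f(2,3)[OF z(1)] z commute[of y "f z"]
      by (intro bexI[of _ z]) auto
  qed
  then have "CR `` {b} \<otimes>\<^bsub>S\<^esub> CR `` {a} = \<one>\<^bsub>S\<^esub>"
    unfolding mult_eq_one_iff[OF b(1) a(1)] by blast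
  then show "t \<otimes>\<^bsub>S\<^esub> s = \<one>\<^bsub>S\<^esub>"
    using a(2) b(2) by simp
qed

text \<open>A metric on the double is glued along \<open>f\<close>: from \<open>x\<close> walk to
  some \<open>z\<close>, cross to the primed \<open>f z\<close> at cost \<open>K\<close>, then walk
  to the target. It gives a one-sided inverse pair; a two-sided one would force the image of
  \<open>f\<close> to be coarsely dense.\<close>

lemma not_weakly_finiteI:
  assumes f: "\<And>x. x \<in> X \<Longrightarrow> f x \<in> X"
    and C: "\<And>x y. x \<in> X \<Longrightarrow> y \<in> X \<Longrightarrow> \<bar>dX (f x) (f y) - dX x y\<bar> \<le> C"
    and not_dense: "\<And>D. \<exists>y\<in>X. \<forall>x\<in>X. D < dX (f x) y"
  shows "\<not> weakly_finite S"
proof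
  assume wf: "weakly_finite S"
  \<comment> \<open>\<open>K \<ge> 1\<close> keeps the copies apart; \<open>K \<ge> C\<close> lets
    the cost of two crossings pay for the distortion of \<open>f\<close>.\<close>
  define K where "K = max C 1"
  have K: "K \<ge> 1" "K \<ge> C" by (auto simp: K_def)
  define g where "g x y = (INF z\<in>X. dX x z + K + dX (f z) y)" for x y
  have lower: "c \<le> g x y" if "\<And>z. z \<in> X \<Longrightarrow> c \<le> dX x z + K + dX (f z) y" for c x y
    unfolding g_def using that by (simp add: cINF_greatest nonempty)
  have upper: "g x y \<le> dX x z + K + dX (f z) y" if "z \<in> X" for x y z
  proof -
    have "bdd_below ((\<lambda>z. dX x z + K + dX (f z) y) ` X)"
      by (rule bdd_belowI[of _ 0]) (use K in auto)
    then show ?thesis using that unfolding g_def by (rule cINF_lower)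
  qed
  have two: "c \<le> g x y + g x' y'"
    if "\<And>z z'. z \<in> X \<Longrightarrow> z' \<in> X \<Longrightarrow> c \<le> dX x z + K + dX (f z) y + (dX x' z' + K + dX (f z') y')"
    for c x y x' y'
  proof -
    have "c - g x' y' \<le> g x y"
    proof (rule lower)
      fix z assume "z \<in> X"
      have "c - (dX x z + K + dX (f z) y) \<le> g x' y'"
        by (rule lower) (use that[OF \<open>z \<in> X\<close>] in fastforce)
      then show "c - g x' y' \<le> dX x z + K + dX (f z) y" by simp
    qed
    then show ?thesis by simp
  qed
  have nn: "0 \<le> g x y" for x y by (rule lower) (use K in simp)
  have one: "1 \<le> g x y" for x y by (rule lower) (use K in \<open>simp add: add_increasing add_increasing2\<close>)
  have tri1: "g x y \<le> dX x z + g z y" if "x \<in> X" "y \<in> X" "z \<in> X" for x y z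
  proof -
    have "g x y - dX x z \<le> g z y"
    proof (rule lower)
      fix w assume "w \<in> X"
      then show "g x y - dX x z \<le> dX z w + K + dX (f w) y"
        using upper[of w x y] triangle[of x z w] that by simp
    qed
    then show ?thesis by simp
  qed
  have tri2: "g x y \<le> g x z + dX z y" if "x \<in> X" "y \<in> X" "z \<in> X" for x y z
  proof -
    have "g x y - dX z y \<le> g x z"
    proof (rule lower)
      fix w assume "w \<in> X"
      then show "g x y - dX z y \<le> dX x w + K + dX (f w) z"
        using upper[of w x y] triangle[of "f w" z y] that f[of w] by simp
    qed
    then show ?thesis by simp
  qed
  \<comment> \<open>Here and in \<open>tri4\<close> the route crosses twice, at \<open>v\<close> and
    at \<open>w\<close>, so \<open>dX v w\<close> must be compared with
    \<open>dX (f v) (f w)\<close>; this is where the distortion bound enters.\<close>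
  have tri3: "dX x y \<le> g x z + g y z" if "x \<in> X" "y \<in> X" "z \<in> X" for x y z
  proof (rule two)
    fix v w assume vw: "v \<in> X" "w \<in> X"
    show "dX x y \<le> dX x v + K + dX (f v) z + (dX y w + K + dX (f w) z)"
      using C[OF vw] triangle[of x v y] triangle[of v w y] triangle[of "f v" z "f w"] K that vw f
        commute[of y w] commute[of z "f w"] by fastforce
  qed
  have tri4: "dX x y \<le> g z x + g z y" if "x \<in> X" "y \<in> X" "z \<in> X" for x y z
  proof (rule two)
    fix v w assume vw: "v \<in> X" "w \<in> X"
    show "dX x y \<le> dX z v + K + dX (f v) x + (dX z w + K + dX (f w) y)"
      using C[OF vw] triangle[of x "f v" y] triangle[of "f v" "f w" y] triangle[of v z w] K that vw f
        commute[of x "f v"] commute[of v z] by fastforce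
  qed
  \<comment> \<open>The roles of the copies are exchanged, so \<open>a\<close> represents the
    pseudo-inverse of the class of \<open>b\<close>.\<close>
  define a where "a = double_of dX (\<lambda>x y. g y x)"
  define b where "b = double_of dX g"
  have b: "b \<in> DM"
    unfolding b_def
    by (rule double_of_in_double_metrics[of _ 1]) (use nn one tri1 tri2 tri3 tri4 in auto)
  have a: "a \<in> DM"
    unfolding a_def
  proof (rule double_of_in_double_metrics[of _ 1])
    fix x y z assume "x \<in> X" "y \<in> X" "z \<in> X"
    then show "g y x \<le> dX x z + g y z" "g y x \<le> g z x + dX z y"
      "dX x y \<le> g z x + g z y" "dX x y \<le> g x z + g y z"
      using tri2[of y x z] tri1[of y x z] tri3[of x y z] tri4[of x y z] commute[of x z] commute[of y z]
      by auto
  qed (use nn one in auto)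
  have "g x (f x) \<le> K" if "x \<in> X" for x
    using upper[OF that, of x "f x"] that f by simp
  then have "CR `` {a} \<otimes>\<^bsub>S\<^esub> CR `` {b} = \<one>\<^bsub>S\<^esub>"
    unfolding mult_eq_one_iff[OF a b] using f by (auto simp: a_def b_def intro!: exI[of _ K])
  then have "CR `` {b} \<otimes>\<^bsub>S\<^esub> CR `` {a} = \<one>\<^bsub>S\<^esub>"
    using wf a b unfolding weakly_finite_iff_directly_finite carrier_eq by blast
  \<comment> \<open>As \<open>a\<close> is the transpose of \<open>b\<close>, both bounds in the
    criterion say the same about \<open>g\<close>.\<close>
  then obtain D where D: "\<And>y. y \<in> X \<Longrightarrow> \<exists>x\<in>X. g x y \<le> D"
    unfolding mult_eq_one_iff[OF b a] by (auto simp: a_def b_def)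
  obtain y where y: "y \<in> X" "\<And>x. x \<in> X \<Longrightarrow> D < dX (f x) y"
    using not_dense by blast
  obtain x where "x \<in> X" "g x y \<le> D"
    using D[OF y(1)] by blast
  \<comment> \<open>Strict bounds on the terms need not survive the infimum; the crossing cost
    \<open>K \<ge> 1\<close> supplies a uniform margin.\<close>
  moreover have "D + 1 \<le> g x y"
  proof (rule lower)
    fix z assume "z \<in> X"
    then show "D + 1 \<le> dX x z + K + dX (f z) y"
      using y(2)[of z] K nonneg[of x z] by linarith
  qed
  ultimately show False by simp
qed

end

section \<open>Two coarsely equivalent spaces\<close>

text \<open>For monotone \<open>h\<close> this is an ultrametric on the naturals in which
  \<open>n\<close> has distance at least \<open>h n\<close> from every other point. The naturals are
  taken inside the reals so that \<open>h\<close> applies directly.\<close>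

definition max_metric :: "(real \<Rightarrow> real) \<Rightarrow> real \<Rightarrow> real \<Rightarrow> real" where
  "max_metric h x y = (if x = y then 0 else h (max x y))"

lemma nonempty_metric_space_max_metric:
  assumes mono: "mono_on {0..} h" and pos: "\<And>t. 0 < t \<Longrightarrow> 0 < h t" and nonneg: "\<And>t. 0 \<le> h t"
  shows "nonempty_metric_space \<nat> (max_metric h)"
proof
  fix x y z :: real
  show "0 \<le> max_metric h x y" by (simp add: max_metric_def nonneg)
  show "max_metric h x y = max_metric h y x" by (simp add: max_metric_def max.commute)
  assume x: "x \<in> \<nat>" and y: "y \<in> \<nat>"
  then have "0 < max x y" if "x \<noteq> y"
    using that by (auto simp: Nats_altdef2 max_def)
  then show "(max_metric h x y = 0) = (x = y)"
    using pos[of "max x y"] by (cases "x = y") (simp_all add: max_metric_def)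
  assume z: "z \<in> \<nat>"
  have "h (max x z) \<le> max (h (max x y)) (h (max y z))"
    using mono_onD[OF mono, of "max x z" "max x y"] mono_onD[OF mono, of "max x z" "max y z"]
      x y z by (fastforce simp: Nats_altdef2)
  then show "max_metric h x z \<le> max_metric h x y + max_metric h y z"
    using nonneg[of "max x y"] nonneg[of "max y z"] by (auto simp: max_metric_def)
next
  show "(\<nat> :: real set) \<noteq> {}" by auto
qed

text \<open>The identity is the equivalence: the new distance is a function of the old one, so
  \<open>ln (1 + t)\<close> serves as both control functions.\<close>

lemma coarsely_equivalent_spaces_ln:
  assumes "\<And>x y. 0 \<le> dX x y" "\<And>x. x \<in> X \<Longrightarrow> dX x x = 0"
  shows "coarsely_equivalent_spaces X dX X (\<lambda>x y. ln (1 + dX x y))"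
proof -
  have "filterlim (\<lambda>t::real. ln (1 + t)) at_top at_top"
    by (rule filterlim_compose[OF ln_at_top])
      (rule filterlim_tendsto_add_at_top[OF tendsto_const filterlim_ident])
  then have "coarse_control (\<lambda>t. ln (1 + t))"
    unfolding coarse_control_def by (auto intro!: mono_onI)
  then show ?thesis
    unfolding coarsely_equivalent_spaces_def using assms
    by (intro bexI[of _ "\<lambda>x. x"] conjI exI[of _ "\<lambda>t. ln (1 + t)"] exI[of _ 0])
      (auto intro!: bexI)
qed

section \<open>The quadratic metric is weakly finite\<close>

text \<open>The distance from 0 to \<open>x\<close> is the square of \<open>x\<close>, and its image
  distance is again a square of a natural number, within \<open>C\<close> of it. Other squares are
  at least \<open>x > C\<close> away, so the larger of \<open>f 0\<close> and \<open>f x\<close> is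
  \<open>x\<close>; as \<open>f 0 < x\<close>, it is \<open>f x\<close>.\<close>

lemma max_square_rigid:
  assumes f: "f \<in> \<nat> \<rightarrow> \<nat>"
    and C: "\<And>x y. x \<in> \<nat> \<Longrightarrow> y \<in> \<nat> \<Longrightarrow>
      \<bar>max_metric (\<lambda>t. t\<^sup>2) (f x) (f y) - max_metric (\<lambda>t. t\<^sup>2) x y\<bar> \<le> C"
    and x: "x \<in> \<nat>" "C < x" "f 0 < x" "1 \<le> x"
  shows "f x = x"
proof -
  have gap: "C < \<bar>k\<^sup>2 - x\<^sup>2\<bar>" if "k \<in> \<nat>" "k \<noteq> x" for k :: real
  proof -
    have "k - x \<in> \<int>" using that x(1) Nats_subset_Ints by (intro Ints_diff) auto
    then have "1 \<le> \<bar>k - x\<bar>" using that(2) by (intro Ints_nonzero_abs_ge1) auto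
    moreover have "x \<le> k + x" using that(1) by (simp add: Nats_altdef2)
    ultimately have "x \<le> \<bar>k - x\<bar> * (k + x)"
      using mult_mono[of 1 "\<bar>k - x\<bar>" x "k + x"] x(4) by simp
    also have "\<dots> = \<bar>k\<^sup>2 - x\<^sup>2\<bar>"
      using \<open>x \<le> k + x\<close> x(4) by (simp add: power2_eq_square square_diff_square_factored abs_mult mult.commute)
    finally show ?thesis using x(2) by simp
  qed
  have f0: "f 0 \<in> \<nat>" "f x \<in> \<nat>" using f x(1) by auto
  have max0: "max 0 x = x" using x(4) by simp
  have C0: "\<bar>max_metric (\<lambda>t. t\<^sup>2) (f 0) (f x) - x\<^sup>2\<bar> \<le> C"
    using C[of 0 x] x max0 by (simp add: max_metric_def)
  \<comment> \<open>Equal images would have distance 0, which is the square of 0 and excluded by the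
    gap at \<open>k = 0\<close>.\<close>
  have "f 0 \<noteq> f x"
    using C0 gap[of 0] x(4) by (auto simp: max_metric_def)
  then have "\<bar>(max (f 0) (f x))\<^sup>2 - x\<^sup>2\<bar> \<le> C"
    using C0 by (simp add: max_metric_def)
  moreover have "max (f 0) (f x) \<in> \<nat>" using f0 by (simp add: max_def)
  ultimately have "max (f 0) (f x) = x"
    using gap by (meson not_le)
  with x(3) show ?thesis by (auto simp: max_def split: if_splits)
qed

lemma weakly_finite_max_square:
  "weakly_finite (double_semigroup \<nat> (max_metric (\<lambda>t. t\<^sup>2)))"
proof -
  interpret nonempty_metric_space \<nat> "max_metric (\<lambda>t. t\<^sup>2)"
    by (rule nonempty_metric_space_max_metric) (auto intro!: mono_onI power_mono)
  show ?thesis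
  proof (rule weakly_finiteI)
    fix f C assume f: "f \<in> \<nat> \<rightarrow> (\<nat> :: real set)"
      and C: "\<And>x y. x \<in> \<nat> \<Longrightarrow> y \<in> \<nat> \<Longrightarrow>
        \<bar>max_metric (\<lambda>t. t\<^sup>2) (f x) (f y) - max_metric (\<lambda>t. t\<^sup>2) x y\<bar> \<le> C"
    \<comment> \<open>Beyond \<open>N\<close> all thresholds of \<open>max_square_rigid\<close> are
      met, so \<open>f\<close> fixes every larger number.\<close>
    define N where "N = max 1 (max C (f 0))"
    have f0: "f 0 \<in> \<nat>" using f by auto
    have "\<exists>x\<in>\<nat>. max_metric (\<lambda>t. t\<^sup>2) (f x) y \<le> N\<^sup>2" if y: "y \<in> \<nat>" for y
    proof (cases "N < y")
      case True
      then have "f y = y"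
        using max_square_rigid[OF f C y] by (simp add: N_def)
      then show ?thesis
        using y by (intro bexI[of _ y]) (simp_all add: max_metric_def)
    next
      case False
      \<comment> \<open>The remaining points, and \<open>f 0\<close> itself, lie below
        \<open>N\<close>, so 0 serves as the witness for all of them.\<close>
      then have "max (f 0) y \<le> N" "0 \<le> max (f 0) y"
        using y by (auto simp: N_def Nats_altdef2 max_def)
      then have "(max (f 0) y)\<^sup>2 \<le> N\<^sup>2" by (rule power_mono)
      then show ?thesis
        by (intro bexI[of _ 0]) (simp_all add: max_metric_def)
    qed
    then show "\<exists>D. \<forall>y\<in>\<nat>. \<exists>x\<in>\<nat>. max_metric (\<lambda>t. t\<^sup>2) (f x) y \<le> D" by blast
  qed
qed

section \<open>The logarithmic metric is not weakly finite\<close>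

lemma nonempty_metric_space_max_ln:
  "nonempty_metric_space \<nat> (max_metric (\<lambda>t. ln (1 + t\<^sup>2)))"
  by (rule nonempty_metric_space_max_metric)
    (auto intro!: mono_onI power_mono simp: add_pos_nonneg)

lemma not_weakly_finite_max_ln:
  "\<not> weakly_finite (double_semigroup \<nat> (max_metric (\<lambda>t. ln (1 + t\<^sup>2))))"
proof -
  let ?d = "max_metric (\<lambda>t. ln (1 + t\<^sup>2))"
  interpret nonempty_metric_space \<nat> ?d
    by (rule nonempty_metric_space_max_ln)
  show ?thesis
  proof (rule not_weakly_finiteI[where f = "\<lambda>x. 2 * x"])
    show "2 * x \<in> \<nat>" if "x \<in> \<nat>" for x :: real using that by auto
    show "\<bar>?d (2 * x) (2 * y) - ?d x y\<bar> \<le> ln 4" if "x \<in> \<nat>" "y \<in> \<nat>" for x y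
    proof (cases "x = y")
      case False
      \<comment> \<open>Doubling multiplies \<open>1 + t\<^sup>2\<close> by a factor between 1 and
        4, which the logarithm turns into a bounded difference.\<close>
      have "ln (1 + (2 * t)\<^sup>2) - ln (1 + t\<^sup>2) \<in> {0..ln 4}" for t :: real
      proof -
        have "ln (1 + (2 * t)\<^sup>2) \<le> ln (4 * (1 + t\<^sup>2))"
          by (subst ln_le_cancel_iff) (auto simp: add_pos_nonneg power_mult_distrib)
        also have "\<dots> = ln 4 + ln (1 + t\<^sup>2)"
          by (rule ln_mult_pos) (auto simp: add_pos_nonneg)
        finally have "ln (1 + (2 * t)\<^sup>2) - ln (1 + t\<^sup>2) \<le> ln 4" by simp
        moreover have "ln (1 + t\<^sup>2) \<le> ln (1 + (2 * t)\<^sup>2)"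
          by (subst ln_le_cancel_iff) (auto simp: add_pos_nonneg power_mult_distrib)
        ultimately show ?thesis by simp
      qed
      moreover have "max (2 * x) (2 * y) = 2 * max x y" by (simp add: max_def)
      ultimately show ?thesis using False by (simp add: max_metric_def abs_le_iff)
    qed (simp add: max_metric_def)
    show "\<exists>y\<in>\<nat>. \<forall>x\<in>\<nat>. D < ?d (2 * x) y" for D
    proof -
      obtain n :: nat where n: "exp D < real n" using reals_Archimedean2 by blast
      \<comment> \<open>An odd number is never of the form \<open>2 * x\<close>, so its distance
        from the image is at least \<open>ln (1 + y\<^sup>2)\<close>, which exceeds \<open>D\<close>
        by the choice of \<open>n\<close>.\<close>
      define y where "y = real (2 * n + 1)"
      have "D < ?d (2 * x) y" if "x \<in> \<nat>" for x
      proof -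
        from that obtain m where m: "x = real m" by (rule Nats_cases)
        have "2 * m \<noteq> 2 * n + 1" by presburger
        then have ne: "2 * x \<noteq> y"
          unfolding m y_def by (metis of_nat_eq_iff of_nat_mult of_nat_numeral)
        have "exp D < y" using n by (simp add: y_def)
        also have "y \<le> y * y" using mult_left_mono[of 1 y y] by (simp add: y_def)
        also have "\<dots> \<le> (max (2 * x) y)\<^sup>2"
          unfolding power2_eq_square by (intro mult_mono) (auto simp: y_def m)
        finally have "exp D < 1 + (max (2 * x) y)\<^sup>2" by simp
        then have "ln (exp D) < ln (1 + (max (2 * x) y)\<^sup>2)"
          by (rule ln_less_cancel_iff[THEN iffD2, rotated 2]) (auto simp: add_pos_nonneg)
        then show ?thesis using ne by (simp add: max_metric_def)
      qed
      moreover have "y \<in> \<nat>" unfolding y_def by (rule of_nat_in_Nats)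
      ultimately show ?thesis by blast
    qed
  qed
qed

theorem mainTheorem9:
  shows "\<exists>(X :: real set) dX (Y :: real set) dY.
    X \<noteq> {} \<and> Y \<noteq> {} \<and> Metric_space X dX \<and> Metric_space Y dY \<and>
    coarsely_equivalent_spaces X dX Y dY \<and>
    weakly_finite (double_semigroup X dX) \<and> \<not> weakly_finite (double_semigroup Y dY)"
proof -
  let ?dX = "max_metric (\<lambda>t. t\<^sup>2)" and ?dY = "max_metric (\<lambda>t. ln (1 + t\<^sup>2))"
  interpret X: nonempty_metric_space \<nat> ?dX
    by (rule nonempty_metric_space_max_metric) (auto intro!: mono_onI power_mono)
  interpret Y: nonempty_metric_space \<nat> ?dY
    by (rule nonempty_metric_space_max_ln)
  \<comment> \<open>On the diagonal both sides vanish because \<open>ln 1 = 0\<close>.\<close>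
  have "?dY = (\<lambda>x y. ln (1 + ?dX x y))"
    by (auto simp: max_metric_def fun_eq_iff)
  then have "coarsely_equivalent_spaces \<nat> ?dX \<nat> ?dY"
    using coarsely_equivalent_spaces_ln[of ?dX \<nat>] by simp
  then show ?thesis
    using X.nonempty X.Metric_space_axioms Y.Metric_space_axioms
      weakly_finite_max_square not_weakly_finite_max_ln by blast
qed

end
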